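(* Let $\mathcal H$ be a real Hilbert space and let $C_1,C_2,\dots,C_N\subseteq\mathcal H$ be closed and convex sets with nonempty intersection $\bigcap_{i=1}^N C_i\neq\emptyset$. Set $C_{N+1}:=C_1$. For any $x_0\in\mathcal H$, the sequence $(x_n)$ defined by $$x_{n+1}:=\left(\frac{1}{N}\sum_{i=1}^N T_{C_i,C_{i+1}}\right)x_n,\qquad n\geq 0,$$ converges weakly to a point $x\in\mathcal H$ such that $P_{C_i}x=P_{C_j}x$ for all indices $i,j\in\{1,\dots,N\}$. Moreover, $P_{C_j}x\in\bigcap_{i=1}^N C_i$ for each index $j\in\{1,\dots,N\}$.
   Context: For a nonempty closed convex set $C\subseteq\mathcal H$, $P_C:\mathcal H\to C$ denotes the nearest point projection onto $C$, and $R_C:=2P_C-I$ is the reflection about $C$, where $I$ is the identity operator. For nonempty closed convex $A,B\subseteq\mathcal H$, the $2$-set Douglas--Rachford operator is $T_{A,B}:=\frac{1}{2}(I+R_BR_A)$, where products of operators denote composition. *)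

theory Defs
  imports "HOL-Analysis.Analysis"
begin

text \<open>A real Hilbert space is a type of sort \<open>{real_inner, banach}\<close>.  The library's
  \<open>closest_point\<close> is restricted to the sort \<open>heine_borel\<close>, i.e. to
  finite dimension, and therefore cannot be used here.\<close>

text \<open>The nearest point exists and is unique, so that the description is proper, whenever
  \<open>C\<close> is nonempty, closed and convex; otherwise the value may be unspecified.\<close>

definition nearest_point_proj :: "'a::{real_inner,banach} set \<Rightarrow> 'a \<Rightarrow> 'a"
  where "nearest_point_proj C x = (THE p. p \<in> C \<and> (\<forall>y\<in>C. dist x p \<le> dist x y))"

definition reflection :: "'a::{real_inner,banach} set \<Rightarrow> 'a \<Rightarrow> 'a"
  where "reflection C x = 2 *\<^sub>R nearest_point_proj C x - x"

text \<open>Note the order of composition: the reflection about \<open>A\<close> is applied first.\<close>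

definition douglas_rachford :: "'a::{real_inner,banach} set \<Rightarrow> 'a set \<Rightarrow> 'a \<Rightarrow> 'a"
  where "douglas_rachford A B x = (1 / 2) *\<^sub>R (x + (reflection B \<circ> reflection A) x)"

text \<open>Convergence in the weak topology of a Hilbert space, i.e. the coarsest topology making all
  functionals \<open>\<lambda>x. x \<bullet> y\<close> continuous.\<close>

definition weakly_converges :: "(nat \<Rightarrow> 'a::{real_inner,banach}) \<Rightarrow> 'a \<Rightarrow> bool"
  where "weakly_converges X l \<longleftrightarrow> (\<forall>y. (\<lambda>n. X n \<bullet> y) \<longlonglongrightarrow> l \<bullet> y)"

end

theory Submission
  imports Defs
begin

text \<open>The average of the Douglas--Rachford operators is firmly nonexpansive, so its orbits are
  Fejer monotone and asymptotically regular, and converge weakly to a fixed point. Weak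
  compactness is avoided by working with asymptotic centers (minimizers of the limit superior of
  the distances to a bounded sequence). A fixed point \<open>l\<close> of the average is fixed by every
  \<open>T\<close>, which puts the projection of \<open>l\<close> onto \<open>C i\<close> into \<open>C (i + 1)\<close>. The distances from
  \<open>l\<close> to the sets are therefore nonincreasing around the cycle, hence all equal, and uniqueness
  of nearest points makes the projections coincide.\<close>

section \<open>Asymptotic centers relative to a convex set\<close>

text \<open>\<open>D\<close> is the least limit superior of \<open>dist (u k) b\<close> along \<open>F\<close> over \<open>b \<in> S\<close>, and
  \<open>a\<close> attains it.\<close>

definition asymptotic_center ::
    "'b filter \<Rightarrow> 'a::metric_space set \<Rightarrow> ('b \<Rightarrow> 'a) \<Rightarrow> 'a \<Rightarrow> real \<Rightarrow> bool"
  where "asymptotic_center F S u a D \<longleftrightarrow> a \<in> S \<and> 0 \<le> D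
    \<and> (\<forall>e>0. \<forall>\<^sub>F k in F. dist (u k) a \<le> D + e)
    \<and> (\<forall>b\<in>S. \<forall>r. (\<forall>\<^sub>F k in F. dist (u k) b \<le> r) \<longrightarrow> D \<le> r)"

lemma dist_midpoint_sq:
  fixes a b u :: "'a::real_inner"
  shows "(dist u (midpoint a b))\<^sup>2 = (dist u a)\<^sup>2 / 2 + (dist u b)\<^sup>2 / 2 - (dist a b)\<^sup>2 / 4"
  unfolding dist_norm power2_norm_eq_inner midpoint_def
  by (simp add: inner_simps inner_commute field_simps)

text \<open>The midpoint of \<open>a\<close> and \<open>b\<close> lies in \<open>S\<close>, and the
  parallelogram law lowers its asymptotic squared radius to
  \<open>r\<^sup>2 - (dist a b)\<^sup>2 / 4\<close>, which cannot fall below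
  \<open>D\<^sup>2\<close>. Both uniqueness and existence of centers rest on this bound.\<close>

lemma near_centers_close:
  fixes u :: "'b \<Rightarrow> 'a::real_inner"
  assumes "F \<noteq> bot" "convex S" "a \<in> S" "b \<in> S" "0 \<le> D"
    and D: "\<And>z r. z \<in> S \<Longrightarrow> \<forall>\<^sub>F k in F. dist (u k) z \<le> r \<Longrightarrow> D \<le> r"
    and a: "\<forall>\<^sub>F k in F. dist (u k) a \<le> r" and b: "\<forall>\<^sub>F k in F. dist (u k) b \<le> r"
  shows "(dist a b)\<^sup>2 \<le> 4 * (r\<^sup>2 - D\<^sup>2)"
proof -
  define s where "s = r\<^sup>2 - (dist a b)\<^sup>2 / 4"
  have "\<forall>\<^sub>F k in F. (dist (u k) (midpoint a b))\<^sup>2 \<le> s"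
    using a b
  proof eventually_elim
    case (elim k)
    then have "(dist (u k) a)\<^sup>2 \<le> r\<^sup>2" "(dist (u k) b)\<^sup>2 \<le> r\<^sup>2"
      by (auto intro: power_mono)
    then show ?case
      by (simp add: dist_midpoint_sq s_def)
  qed
  then have ev: "\<forall>\<^sub>F k in F. dist (u k) (midpoint a b) \<le> sqrt s"
    by eventually_elim (rule real_le_rsqrt)
  have "midpoint a b \<in> S"
    using assms(2-4) closed_segment_subset midpoint_in_closed_segment by blast
  then have "D \<le> sqrt s"
    using D ev by blast
  \<comment> \<open>The real \<open>sqrt\<close> is negative at negative arguments, so
    \<open>0 \<le> D \<le> sqrt s\<close> also rules out \<open>s < 0\<close>.\<close>
  then have "D\<^sup>2 \<le> s"
    using \<open>0 \<le> D\<close> by (simp add: real_le_rsqrt real_sqrt_ge_0_iff sqrt_ge_absD)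
  then show ?thesis
    by (simp add: s_def)
qed

text \<open>Both points are within \<open>D + e\<close> eventually, so the previous bound applies
  with \<open>r = D + e\<close> and tends to 0 as \<open>e\<close> decreases to 0.\<close>

lemma asymptotic_center_unique:
  fixes u :: "'b \<Rightarrow> 'a::real_inner"
  assumes "F \<noteq> bot" "convex S" and c: "asymptotic_center F S u a D" and "b \<in> S"
    and b: "\<And>e. e > 0 \<Longrightarrow> \<forall>\<^sub>F k in F. dist (u k) b \<le> D + e"
  shows "b = a"
proof -
  have "(dist a b)\<^sup>2 \<le> 4 * ((D + e)\<^sup>2 - D\<^sup>2)" if "e > 0" for e
    using c assms that unfolding asymptotic_center_def
    by (intro near_centers_close[where F = F and u = u and S = S]) auto
  then have "\<forall>\<^sub>F e in at_right 0. (dist a b)\<^sup>2 \<le> 4 * ((D + e)\<^sup>2 - D\<^sup>2)"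
    by (simp add: eventually_at_right_less eventually_mono[OF eventually_at_right_less])
  moreover have "((\<lambda>e. 4 * ((D + e)\<^sup>2 - D\<^sup>2)) \<longlongrightarrow> 4 * ((D + 0)\<^sup>2 - D\<^sup>2)) (at_right 0)"
    by (intro tendsto_intros)
  ultimately have "(dist a b)\<^sup>2 \<le> 4 * ((D + 0)\<^sup>2 - D\<^sup>2)"
    by (intro tendsto_lowerbound[where F = "at_right 0"]) auto
  then show ?thesis
    by simp
qed

text \<open>A minimizing sequence for the asymptotic radius is Cauchy by
  \<open>near_centers_close\<close>, so completeness does the work of weak compactness.\<close>

lemma asymptotic_center_exists:
  fixes u :: "'b \<Rightarrow> 'a::{real_inner,banach}"
  assumes "F \<noteq> bot" "convex S" "closed S" "c \<in> S" and bnd: "\<forall>\<^sub>F k in F. dist (u k) c \<le> M"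
  obtains a D where "asymptotic_center F S u a D"
proof -
  define R where "R = {r. \<exists>z\<in>S. \<forall>\<^sub>F k in F. dist (u k) z \<le> r}"
  define D where "D = Inf R"
  have nonneg: "0 \<le> r" if r: "r \<in> R" for r
  proof -
    obtain z where "\<forall>\<^sub>F k in F. dist (u k) z \<le> r"
      using r by (auto simp: R_def)
    then obtain k where "dist (u k) z \<le> r"
      using eventually_happens' \<open>F \<noteq> bot\<close> by blast
    then show ?thesis
      using zero_le_dist order_trans by blast
  qed
  have "M \<in> R"
    using assms by (auto simp: R_def)
  have bdd: "bdd_below R"
    using nonneg by (auto simp: bdd_below_def)
  have "0 \<le> D"
    unfolding D_def using nonneg \<open>M \<in> R\<close> by (intro cInf_greatest) auto
  have D: "D \<le> r" if "z \<in> S" "\<forall>\<^sub>F k in F. dist (u k) z \<le> r" for z r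
    unfolding D_def using that bdd by (intro cInf_lower) (auto simp: R_def)
  have "\<exists>z\<in>S. \<forall>\<^sub>F k in F. dist (u k) z \<le> D + e" if e: "e > 0" for e
  proof -
    obtain r where r: "r \<in> R" "r < D + e"
      using cInf_lessD[of R "D + e"] \<open>M \<in> R\<close> e by (auto simp: D_def)
    then obtain z where "z \<in> S" "\<forall>\<^sub>F k in F. dist (u k) z \<le> r"
      by (auto simp: R_def)
    then show ?thesis
      using r(2) by (intro bexI[of _ z]) (auto elim: eventually_mono)
  qed
  then have "\<exists>z. z \<in> S \<and> (\<forall>\<^sub>F k in F. dist (u k) z \<le> D + 1 / real (Suc m))" for m
    by (metis of_nat_0_less_iff zero_less_Suc zero_less_divide_1_iff)
  then obtain z where zS: "\<And>m. z m \<in> S"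
    and z: "\<And>m. \<forall>\<^sub>F k in F. dist (u k) (z m) \<le> D + 1 / real (Suc m)"
    by metis
  have gap: "(dist (z m) (z n))\<^sup>2 \<le> 4 * ((D + 1 / real (Suc k))\<^sup>2 - D\<^sup>2)" if "k \<le> m" "k \<le> n" for k m n
  proof (rule near_centers_close[OF \<open>F \<noteq> bot\<close> \<open>convex S\<close> zS zS \<open>0 \<le> D\<close> D])
    have *: "1 / real (Suc j) \<le> 1 / real (Suc k)" if "k \<le> j" for j
      using that by (simp add: frac_le)
    show "\<forall>\<^sub>F i in F. dist (u i) (z m) \<le> D + 1 / real (Suc k)"
      using z[of m] by eventually_elim (use *[OF \<open>k \<le> m\<close>] in linarith)
    show "\<forall>\<^sub>F i in F. dist (u i) (z n) \<le> D + 1 / real (Suc k)"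
      using z[of n] by eventually_elim (use *[OF \<open>k \<le> n\<close>] in linarith)
  qed
  have "Cauchy z"
  proof (rule metric_CauchyI)
    fix e :: real assume "e > 0"
    have "(\<lambda>k. 4 * ((D + 1 / real (Suc k))\<^sup>2 - D\<^sup>2)) \<longlonglongrightarrow> 4 * ((D + 0)\<^sup>2 - D\<^sup>2)"
      by (intro tendsto_intros LIMSEQ_Suc[OF lim_1_over_n])
    then have "\<forall>\<^sub>F k in sequentially. 4 * ((D + 1 / real (Suc k))\<^sup>2 - D\<^sup>2) < e\<^sup>2"
      using \<open>e > 0\<close> by (intro order_tendstoD(2)) auto
    then obtain k where k: "4 * ((D + 1 / real (Suc k))\<^sup>2 - D\<^sup>2) < e\<^sup>2"
      by (auto simp: eventually_sequentially)
    have "dist (z m) (z n) < e" if "k \<le> m" "k \<le> n" for m n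
      using gap[OF that] k \<open>e > 0\<close> by (intro power2_less_imp_less[of _ e]) auto
    then show "\<exists>k. \<forall>m\<ge>k. \<forall>n\<ge>k. dist (z m) (z n) < e"
      by blast
  qed
  then obtain a where a: "z \<longlonglongrightarrow> a"
    using Cauchy_convergent_iff convergent_def by blast
  have "a \<in> S"
    using closed_sequentially[OF \<open>closed S\<close> _ a] zS by blast
  have "\<forall>\<^sub>F k in F. dist (u k) a \<le> D + e" if "e > 0" for e
  proof -
    have "(\<lambda>m. dist (z m) a + 1 / real (Suc m)) \<longlonglongrightarrow> 0 + 0"
      by (intro tendsto_add LIMSEQ_Suc[OF lim_1_over_n] iffD1[OF tendsto_dist_iff a])
    then have "\<forall>\<^sub>F m in sequentially. dist (z m) a + 1 / real (Suc m) < e"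
      using \<open>e > 0\<close> by (intro order_tendstoD(2)) auto
    then obtain m where m: "dist (z m) a + 1 / real (Suc m) < e"
      by (auto simp: eventually_sequentially)
    from z[of m] show ?thesis
    proof eventually_elim
      case (elim k)
      then show ?case
        using m dist_triangle[of "u k" a "z m"] by linarith
    qed
  qed
  then have "asymptotic_center F S u a D"
    using \<open>a \<in> S\<close> \<open>0 \<le> D\<close> D unfolding asymptotic_center_def by blast
  then show ?thesis
    by (rule that)
qed

section \<open>Nearest points in closed convex sets\<close>

lemma nearest_point_proj:
  fixes C :: "'a::{real_inner,banach} set"
  assumes "closed C" "convex C" "C \<noteq> {}"
  shows "nearest_point_proj C x \<in> C"
    and "y \<in> C \<Longrightarrow> dist x (nearest_point_proj C x) \<le> dist x y"
proof -
  obtain c where "c \<in> C"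
    using assms by blast
  \<comment> \<open>The nearest point is the asymptotic center of a constant sequence relative to \<open>C\<close>.\<close>
  define F where "F = (sequentially :: nat filter)"
  have F: "F \<noteq> bot" "eventually (\<lambda>k. P) F \<longleftrightarrow> P" for P
    by (auto simp: F_def)
  obtain p D where p: "asymptotic_center F C (\<lambda>_. x) p D"
    using asymptotic_center_exists[where F = F and u = "\<lambda>_. x", of C c "dist x c"] assms \<open>c \<in> C\<close> F by auto
  have D: "D \<le> dist x y" if "y \<in> C" for y
    using p that F unfolding asymptotic_center_def by auto
  have "dist x p \<le> D"
    using p F unfolding asymptotic_center_def by (auto intro: field_le_epsilon)
  with D have "p \<in> C \<and> (\<forall>y\<in>C. dist x p \<le> dist x y)"
    using p order_trans unfolding asymptotic_center_def by blast
  moreover have "q = p" if "q \<in> C \<and> (\<forall>y\<in>C. dist x q \<le> dist x y)" for q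
    using that calculation any_closest_point_unique[of C q p x] assms by blast
  ultimately have "nearest_point_proj C x \<in> C \<and> (\<forall>y\<in>C. dist x (nearest_point_proj C x) \<le> dist x y)"
    unfolding nearest_point_proj_def by (rule theI)
  then show "nearest_point_proj C x \<in> C"
    and "y \<in> C \<Longrightarrow> dist x (nearest_point_proj C x) \<le> dist x y"
    by auto
qed

lemma nearest_point_proj_unique:
  fixes C :: "'a::{real_inner,banach} set"
  assumes "closed C" "convex C" "p \<in> C" "dist x p \<le> dist x (nearest_point_proj C x)"
  shows "nearest_point_proj C x = p"
  using assms nearest_point_proj[of C] any_closest_point_unique[of C _ p x]
  by (metis empty_iff order_trans)

section \<open>Firmly nonexpansive operators and their averages\<close>

text \<open>The inner-product form is chosen because its right-hand side is linear in \<open>T\<close>, so that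
  only the squared norm on the left needs an argument under averaging.\<close>

definition firmly_nonexpansive :: "('a::real_inner \<Rightarrow> 'a) \<Rightarrow> bool"
  where "firmly_nonexpansive T \<longleftrightarrow> (\<forall>x y. (norm (T x - T y))\<^sup>2 \<le> (T x - T y) \<bullet> (x - y))"

lemma firmly_nonexpansiveD:
  "firmly_nonexpansive T \<Longrightarrow> (norm (T x - T y))\<^sup>2 \<le> (T x - T y) \<bullet> (x - y)"
  by (simp add: firmly_nonexpansive_def)

text \<open>With \<open>u = T x - T y\<close> and \<open>v = x - y\<close>, the left side minus the
  right is twice \<open>u \<bullet> u - u \<bullet> v\<close>. The displacement term on the left
  later yields asymptotic regularity.\<close>

lemma firmly_nonexpansive_sq:
  assumes "firmly_nonexpansive T"
  shows "(norm (T x - T y))\<^sup>2 + (norm ((x - T x) - (y - T y)))\<^sup>2 \<le> (norm (x - y))\<^sup>2"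
  using firmly_nonexpansiveD[OF assms, of x y] unfolding power2_norm_eq_inner
  by (simp add: inner_simps inner_commute)

lemma firmly_nonexpansive_norm_le:
  assumes "firmly_nonexpansive T"
  shows "norm (T x - T y) \<le> norm (x - y)"
proof (rule power2_le_imp_le)
  show "(norm (T x - T y))\<^sup>2 \<le> (norm (x - y))\<^sup>2"
    using firmly_nonexpansive_sq[OF assms, of x y] zero_le_power2[of "norm ((x - T x) - (y - T y))"]
    by linarith
qed simp

text \<open>The obtuse-angle inequalities at the two projections, each tested against the other
  projection, add up to the claim.\<close>

lemma firmly_nonexpansive_nearest_point_proj:
  fixes C :: "'a::{real_inner,banach} set"
  assumes "closed C" "convex C" "C \<noteq> {}"
  shows "firmly_nonexpansive (nearest_point_proj C)"
  unfolding firmly_nonexpansive_def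
proof (intro allI)
  fix x y
  define p q where "p = nearest_point_proj C x" and "q = nearest_point_proj C y"
  have "(x - p) \<bullet> (q - p) \<le> 0" "(y - q) \<bullet> (p - q) \<le> 0"
    unfolding p_def q_def using nearest_point_proj[OF assms] assms
    by (intro any_closest_point_dot[of C]; simp)+
  then show "(norm (nearest_point_proj C x - nearest_point_proj C y))\<^sup>2
      \<le> (nearest_point_proj C x - nearest_point_proj C y) \<bullet> (x - y)"
    unfolding p_def[symmetric] q_def[symmetric] power2_norm_eq_inner
    by (simp add: inner_simps inner_commute)
qed

lemma reflection_nonexpansive:
  fixes C :: "'a::{real_inner,banach} set"
  assumes "closed C" "convex C" "C \<noteq> {}"
  shows "norm (reflection C x - reflection C y) \<le> norm (x - y)"
proof (rule power2_le_imp_le)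
  show "(norm (reflection C x - reflection C y))\<^sup>2 \<le> (norm (x - y))\<^sup>2"
    using firmly_nonexpansiveD[OF firmly_nonexpansive_nearest_point_proj[OF assms], of x y]
    unfolding power2_norm_eq_inner reflection_def
    by (simp add: inner_simps inner_commute)
qed simp

text \<open>After expansion the mixed terms cancel, and the claim becomes the squared
  nonexpansiveness of \<open>R\<close>.\<close>

lemma firmly_nonexpansive_half_sum:
  assumes "\<And>x y. norm (R x - R y) \<le> norm (x - y)"
  shows "firmly_nonexpansive (\<lambda>x. (1 / 2) *\<^sub>R (x + R x))"
  unfolding firmly_nonexpansive_def
proof (intro allI)
  fix x y
  have "(norm (R x - R y))\<^sup>2 \<le> (norm (x - y))\<^sup>2"
    using assms by (intro power_mono) auto
  then show "(norm ((1 / 2) *\<^sub>R (x + R x) - (1 / 2) *\<^sub>R (y + R y)))\<^sup>2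
      \<le> ((1 / 2) *\<^sub>R (x + R x) - (1 / 2) *\<^sub>R (y + R y)) \<bullet> (x - y)"
    unfolding power2_norm_eq_inner
    by (simp add: inner_simps inner_commute field_simps)
qed

lemma firmly_nonexpansive_douglas_rachford:
  fixes A B :: "'a::{real_inner,banach} set"
  assumes "closed A" "convex A" "A \<noteq> {}" "closed B" "convex B" "B \<noteq> {}"
  shows "firmly_nonexpansive (douglas_rachford A B)"
proof -
  have "norm ((reflection B \<circ> reflection A) x - (reflection B \<circ> reflection A) y) \<le> norm (x - y)" for x y
    using reflection_nonexpansive[OF assms(4-6)] reflection_nonexpansive[OF assms(1-3)]
    by (metis comp_apply order_trans)
  then show ?thesis
    using firmly_nonexpansive_half_sum[of "reflection B \<circ> reflection A"]
    by (simp only: douglas_rachford_def[abs_def])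
qed

text \<open>Triangle inequality followed by Cauchy-Schwarz. If \<open>card I = 0\<close>, division
  by zero makes both sides 0.\<close>

lemma norm_mean_sq_le:
  fixes f :: "'i \<Rightarrow> 'a::real_normed_vector"
  shows "(norm ((1 / real (card I)) *\<^sub>R (\<Sum>i\<in>I. f i)))\<^sup>2 \<le> (1 / real (card I)) * (\<Sum>i\<in>I. (norm (f i))\<^sup>2)"
proof (cases "card I = 0")
  case False
  have "(norm (\<Sum>i\<in>I. f i))\<^sup>2 \<le> (\<Sum>i\<in>I. norm (f i))\<^sup>2"
    by (intro power_mono norm_sum) simp
  also have "\<dots> \<le> (\<Sum>i\<in>I. (norm (f i))\<^sup>2) * card I"
    by (rule sum_squared_le_sum_of_squares)
  finally show ?thesis
    using False by (simp add: power_divide power2_eq_square field_simps)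
qed simp

lemma firmly_nonexpansive_mean:
  assumes "\<And>i. i \<in> I \<Longrightarrow> firmly_nonexpansive (T i)"
  shows "firmly_nonexpansive (\<lambda>x. (1 / real (card I)) *\<^sub>R (\<Sum>i\<in>I. T i x))"
  unfolding firmly_nonexpansive_def
proof (intro allI)
  fix x y
  let ?m = "(1 / real (card I)) *\<^sub>R (\<Sum>i\<in>I. T i x - T i y)"
  have "(norm ?m)\<^sup>2 \<le> (1 / real (card I)) * (\<Sum>i\<in>I. (norm (T i x - T i y))\<^sup>2)"
    by (rule norm_mean_sq_le)
  also have "\<dots> \<le> (1 / real (card I)) * (\<Sum>i\<in>I. (T i x - T i y) \<bullet> (x - y))"
    using assms by (intro mult_left_mono sum_mono firmly_nonexpansiveD) auto
  also have "\<dots> = ?m \<bullet> (x - y)"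
    by (simp add: inner_sum_left)
  finally show "(norm ((1 / real (card I)) *\<^sub>R (\<Sum>i\<in>I. T i x) - (1 / real (card I)) *\<^sub>R (\<Sum>i\<in>I. T i y)))\<^sup>2
      \<le> ((1 / real (card I)) *\<^sub>R (\<Sum>i\<in>I. T i x) - (1 / real (card I)) *\<^sub>R (\<Sum>i\<in>I. T i y)) \<bullet> (x - y)"
    by (simp add: sum_subtractf scaleR_right_diff_distrib)
qed

text \<open>Firm nonexpansiveness against the common fixed point \<open>c\<close> bounds each
  squared displacement by \<open>(x - T i x) \<bullet> (x - c)\<close>. These bounds sum to 0
  because \<open>x\<close> is the mean of the \<open>T i x\<close>, so every displacement
  vanishes.\<close>

lemma fixed_point_mean_firmly_nonexpansive:
  assumes "finite I" "i \<in> I" and T: "\<And>i. i \<in> I \<Longrightarrow> firmly_nonexpansive (T i)"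
    and c: "\<And>i. i \<in> I \<Longrightarrow> T i c = c"
    and x: "(1 / real (card I)) *\<^sub>R (\<Sum>i\<in>I. T i x) = x"
  shows "T i x = x"
proof -
  have "card I \<noteq> 0"
    using assms by auto
  have sum_T: "(\<Sum>i\<in>I. T i x) = real (card I) *\<^sub>R x"
    by (subst (2) x[symmetric]) (use \<open>card I \<noteq> 0\<close> in simp)
  have "(\<Sum>i\<in>I. (norm (T i x - x))\<^sup>2)
      \<le> (\<Sum>i\<in>I. (x - c) \<bullet> (x - c) - (T i x - c) \<bullet> (x - c))"
  proof (rule sum_mono)
    fix i assume "i \<in> I"
    then show "(norm (T i x - x))\<^sup>2 \<le> (x - c) \<bullet> (x - c) - (T i x - c) \<bullet> (x - c)"
      using firmly_nonexpansiveD[OF T, of i x c] c[of i] unfolding power2_norm_eq_inner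
      by (simp add: inner_simps inner_commute)
  qed
  also have "\<dots> = (\<Sum>i\<in>I. x - T i x) \<bullet> (x - c)"
    by (simp add: inner_sum_left flip: inner_diff_left)
  also have "\<dots> = 0"
    by (simp add: sum_subtractf sum_T sum_constant_scaleR)
  finally have "(\<Sum>i\<in>I. (norm (T i x - x))\<^sup>2) = 0"
    by (simp add: antisym sum_nonneg)
  then show ?thesis
    using \<open>finite I\<close> \<open>i \<in> I\<close> by (simp add: sum_nonneg_eq_0_iff)
qed

section \<open>Asymptotic centers along orbits and weak convergence\<close>

text \<open>Since \<open>u k\<close> is asymptotically close to \<open>T (u k)\<close> and
  \<open>T\<close> is nonexpansive, \<open>T a\<close> is asymptotically no farther from
  \<open>u\<close> than \<open>a\<close> is; uniqueness of the center concludes.\<close>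

lemma asymptotic_center_fixed_point:
  fixes T :: "'a::real_inner \<Rightarrow> 'a"
  assumes "F \<noteq> bot" and T: "\<And>x y. norm (T x - T y) \<le> norm (x - y)"
    and u: "((\<lambda>k. norm (u k - T (u k))) \<longlongrightarrow> 0) F"
    and a: "asymptotic_center F UNIV u a D"
  shows "T a = a"
proof (rule asymptotic_center_unique[OF \<open>F \<noteq> bot\<close> convex_UNIV a UNIV_I])
  fix e :: real assume "e > 0"
  then have "\<forall>\<^sub>F k in F. norm (u k - T (u k)) < e / 2"
    using u by (intro order_tendstoD(2)) auto
  moreover have "\<forall>\<^sub>F k in F. dist (u k) a \<le> D + e / 2"
    using a \<open>e > 0\<close> unfolding asymptotic_center_def by (meson half_gt_zero)
  ultimately show "\<forall>\<^sub>F k in F. dist (u k) (T a) \<le> D + e"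
  proof eventually_elim
    case (elim k)
    then show ?case
      using dist_triangle[of "u k" "T a" "T (u k)"] T[of "u k" a] by (simp add: dist_norm)
  qed
qed

text \<open>Otherwise a short move from \<open>a\<close> in the direction \<open>y\<close> would
  reduce the asymptotic radius.\<close>

lemma asymptotic_center_imp_inner_small:
  fixes u :: "'b \<Rightarrow> 'a::real_inner"
  assumes "F \<noteq> bot" and a: "asymptotic_center F UNIV u a D" and "e > 0"
    and lim: "((\<lambda>k. dist (u k) a) \<longlongrightarrow> D) F"
  shows "\<not> (\<forall>\<^sub>F k in F. e \<le> (u k - a) \<bullet> y)"
proof
  assume ev: "\<forall>\<^sub>F k in F. e \<le> (u k - a) \<bullet> y"
  \<comment> \<open>The move changes the squared distance by \<open>- 2 * t * ((u k - a) \<bullet>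
    y) + t\<^sup>2 * (y \<bullet> y)\<close>. This \<open>t\<close> satisfies
    \<open>t * (y \<bullet> y) \<le> e\<close>, so the change is at most \<open>- t * e\<close>; the
    added 1 covers \<open>y = 0\<close>.\<close>
  define t where "t = e / (y \<bullet> y + 1)"
  have "y \<bullet> y + 1 > 0"
    by (simp add: add_nonneg_pos)
  then have "t > 0"
    using \<open>e > 0\<close> by (simp add: t_def)
  have "t * (y \<bullet> y) \<le> e"
    using \<open>e > 0\<close> \<open>y \<bullet> y + 1 > 0\<close> by (simp add: t_def field_simps)
  then have t2: "t * (t * (y \<bullet> y)) \<le> t * e"
    using \<open>t > 0\<close> by simp
  have "((\<lambda>k. (dist (u k) a)\<^sup>2) \<longlongrightarrow> D\<^sup>2) F"
    using lim by (intro tendsto_intros)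
  then have "\<forall>\<^sub>F k in F. (dist (u k) a)\<^sup>2 < D\<^sup>2 + t * e / 2"
    using \<open>t > 0\<close> \<open>e > 0\<close> by (intro order_tendstoD(2)) auto
  with ev have "\<forall>\<^sub>F k in F. (dist (u k) (a + t *\<^sub>R y))\<^sup>2 \<le> D\<^sup>2 - t * e / 2"
  proof eventually_elim
    case (elim k)
    have "t * e \<le> t * ((u k - a) \<bullet> y)"
      using elim \<open>t > 0\<close> by simp
    moreover have "(dist (u k) (a + t *\<^sub>R y))\<^sup>2
        = (dist (u k) a)\<^sup>2 - 2 * (t * ((u k - a) \<bullet> y)) + t * (t * (y \<bullet> y))"
      unfolding dist_norm power2_norm_eq_inner
      by (simp add: inner_simps inner_commute algebra_simps)
    ultimately show ?case
      using elim t2 by linarith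
  qed
  then have "\<forall>\<^sub>F k in F. dist (u k) (a + t *\<^sub>R y) \<le> sqrt (D\<^sup>2 - t * e / 2)"
    by eventually_elim (rule real_le_rsqrt)
  then have "D \<le> sqrt (D\<^sup>2 - t * e / 2)"
    using a unfolding asymptotic_center_def by blast
  also have "\<dots> < sqrt (D\<^sup>2)"
    using mult_pos_pos[OF \<open>t > 0\<close> \<open>e > 0\<close>] by (subst real_sqrt_less_iff) simp
  also have "\<dots> = D"
    using a by (simp add: asymptotic_center_def)
  finally show False
    by simp
qed

lemma asymptotic_center_radius:
  assumes "F \<noteq> bot" "asymptotic_center F S u a D" "((\<lambda>k. dist (u k) a) \<longlongrightarrow> r) F"
  shows "r = D"
proof (rule antisym)
  have e: "\<forall>\<^sub>F k in F. dist (u k) a \<le> D + e" if "e > 0" for e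
    using assms that unfolding asymptotic_center_def by blast
  then show "r \<le> D"
    using tendsto_upperbound[OF assms(3) _ assms(1)] by (meson field_le_epsilon)
  have "D \<le> r + e" if "e > 0" for e
  proof -
    have "\<forall>\<^sub>F k in F. dist (u k) a < r + e"
      using assms(3) that by (intro order_tendstoD(2)) auto
    then have "\<forall>\<^sub>F k in F. dist (u k) a \<le> r + e"
      by eventually_elim simp
    then show ?thesis
      using assms(2) unfolding asymptotic_center_def by blast
  qed
  then show "D \<le> r"
    by (rule field_le_epsilon)
qed

text \<open>Fejer monotonicity gives the distances to a fixed point a limit along the whole orbit, so
  they cannot tell a subsequence from the orbit. Hence all subsequences share one asymptotic
  center, and this forces weak convergence.\<close>

lemma weakly_converges_nonexpansive_orbit:
  fixes T :: "'a::{real_inner,banach} \<Rightarrow> 'a"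
  assumes T: "\<And>x y. norm (T x - T y) \<le> norm (x - y)" and "T c = c"
    and x: "\<And>n. x (Suc n) = T (x n)"
    and reg: "(\<lambda>n. norm (x n - T (x n))) \<longlonglongrightarrow> 0"
  obtains l where "T l = l" "weakly_converges x l"
proof -
  have dec: "decseq (\<lambda>n. dist (x n) a)" if "T a = a" for a
    using T[of _ a] that x by (auto intro!: decseq_SucI simp: dist_norm)
  have lim: "\<exists>r. (\<lambda>n. dist (x n) a) \<longlonglongrightarrow> r" if "T a = a" for a
    using decseq_convergent[OF dec[OF that], of 0] by (metis zero_le_dist)
  \<comment> \<open>A filter \<open>F\<close> below \<open>sequentially\<close> stands for a
    subsequence. The last conjunct nevertheless concerns the whole orbit: the distances to the fixed
    point \<open>a\<close> converge there, and their limit is the radius along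
    \<open>F\<close>.\<close>
  have center: "\<exists>a D. asymptotic_center F UNIV x a D \<and> T a = a \<and> (\<lambda>n. dist (x n) a) \<longlonglongrightarrow> D"
    if F: "F \<noteq> bot" "F \<le> sequentially" for F
  proof -
    have "\<forall>n. dist (x n) c \<le> dist (x 0) c"
      using dec[OF \<open>T c = c\<close>] by (simp add: decseq_def)
    then obtain a D where a: "asymptotic_center F UNIV x a D"
      using asymptotic_center_exists[OF F(1) convex_UNIV closed_UNIV UNIV_I, of x c "dist (x 0) c"]
      by auto
    moreover have "T a = a"
      using asymptotic_center_fixed_point[OF F(1) T tendsto_mono[OF F(2) reg] a] .
    moreover obtain r where r: "(\<lambda>n. dist (x n) a) \<longlonglongrightarrow> r"
      using lim[OF \<open>T a = a\<close>] by blast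
    moreover have "r = D"
      using asymptotic_center_radius[OF F(1) a tendsto_mono[OF F(2) r]] .
    ultimately show ?thesis
      by blast
  qed
  obtain l D where l: "asymptotic_center sequentially UNIV x l D" "T l = l"
    "(\<lambda>n. dist (x n) l) \<longlonglongrightarrow> D"
    using center[of sequentially] by auto
  \<comment> \<open>A one-sided bound suffices, because it is applied to both \<open>y\<close> and
    \<open>- y\<close>.\<close>
  have ev: "\<forall>\<^sub>F n in sequentially. (x n - l) \<bullet> y < e" if "e > 0" for y e
  proof (rule ccontr)
    assume not_ev: "\<not> ?thesis"
    \<comment> \<open>This filter plays the role of a subsequence violating the claim.\<close>
    define F where "F = inf sequentially (principal {n. e \<le> (x n - l) \<bullet> y})"
    have F: "F \<noteq> bot" "F \<le> sequentially"
      using not_ev by (auto simp: F_def trivial_limit_def eventually_inf_principal not_le)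
    obtain a D' where a: "asymptotic_center F UNIV x a D'" "T a = a" "(\<lambda>n. dist (x n) a) \<longlonglongrightarrow> D'"
      using center[OF F] by blast
    \<comment> \<open>\<open>l\<close> competes with \<open>a\<close> along \<open>F\<close>.
      Conversely, the distances to \<open>a\<close> tend to \<open>D'\<close> along the whole orbit,
      so \<open>D' \<le> D\<close> makes \<open>a\<close> a center of the orbit as well.\<close>
    have "D' \<le> D + d" if "d > 0" for d
    proof -
      have "\<forall>\<^sub>F n in sequentially. dist (x n) l \<le> D + d"
        using l(1) that unfolding asymptotic_center_def by blast
      then show ?thesis
        using a(1) filter_leD[OF F(2)] unfolding asymptotic_center_def by blast
    qed
    then have "D' \<le> D"
      by (rule field_le_epsilon)
    have "a = l"
    proof (rule asymptotic_center_unique[OF _ convex_UNIV l(1)])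
      fix d :: real assume "d > 0"
      then have "\<forall>\<^sub>F n in sequentially. dist (x n) a < D + d"
        using a(3) \<open>D' \<le> D\<close> by (intro order_tendstoD(2)) auto
      then show "\<forall>\<^sub>F n in sequentially. dist (x n) a \<le> D + d"
        by eventually_elim simp
    qed auto
    then have "\<not> (\<forall>\<^sub>F n in F. e \<le> (x n - l) \<bullet> y)"
      using asymptotic_center_imp_inner_small[OF F(1) a(1) \<open>e > 0\<close> tendsto_mono[OF F(2) a(3)]] by simp
    then show False
      by (simp add: F_def eventually_inf_principal)
  qed
  have "(\<lambda>n. x n \<bullet> y) \<longlonglongrightarrow> l \<bullet> y" for y
  proof (rule order_tendstoI)
    fix r assume "r < l \<bullet> y"
    then show "\<forall>\<^sub>F n in sequentially. r < x n \<bullet> y"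
      using ev[of "l \<bullet> y - r" "- y"] by (simp add: inner_simps)
  next
    fix r assume "l \<bullet> y < r"
    then show "\<forall>\<^sub>F n in sequentially. x n \<bullet> y < r"
      using ev[of "r - l \<bullet> y" y] by (simp add: inner_simps)
  qed
  then show ?thesis
    using that l(2) by (auto simp: weakly_converges_def)
qed

text \<open>The squared displacements are bounded by the successive differences of the decreasing,
  hence convergent, squared distances to \<open>c\<close>.\<close>

lemma firmly_nonexpansive_asymptotically_regular:
  assumes T: "firmly_nonexpansive T" and "T c = c" and x: "\<And>n. x (Suc n) = T (x n)"
  shows "(\<lambda>n. norm (x n - T (x n))) \<longlonglongrightarrow> 0"
proof -
  define d where "d n = (norm (x n - c))\<^sup>2" for n
  have le: "(norm (x n - T (x n)))\<^sup>2 \<le> d n - d (Suc n)" for n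
    using firmly_nonexpansive_sq[OF T, of "x n" c] \<open>T c = c\<close> x[of n] by (simp add: d_def)
  have "d (Suc n) \<le> d n" for n
    using le[of n] zero_le_power2[of "norm (x n - T (x n))"] by linarith
  then have "decseq d"
    by (rule decseq_SucI)
  then obtain L where L: "d \<longlonglongrightarrow> L"
    using decseq_convergent[of d 0] by (auto simp: d_def)
  have diff: "(\<lambda>n. d n - d (Suc n)) \<longlonglongrightarrow> 0"
    using tendsto_diff[OF L LIMSEQ_Suc[OF L]] by simp
  have "(\<lambda>n. (norm (x n - T (x n)))\<^sup>2) \<longlonglongrightarrow> 0"
    by (rule tendsto_sandwich[OF _ _ tendsto_const diff])
      (intro always_eventually allI zero_le_power2 le)+
  then show ?thesis
    using tendsto_real_sqrt[of "\<lambda>n. (norm (x n - T (x n)))\<^sup>2" 0] by simp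
qed

section \<open>Fixed points of Douglas-Rachford operators and cyclic projections\<close>

lemma nearest_point_proj_in:
  fixes C :: "'a::{real_inner,banach} set"
  assumes "closed C" "convex C" "c \<in> C"
  shows "nearest_point_proj C c = c"
  using assms by (intro nearest_point_proj_unique) auto

lemma douglas_rachford_common_point:
  fixes A B :: "'a::{real_inner,banach} set"
  assumes "closed A" "convex A" "closed B" "convex B" "c \<in> A \<inter> B"
  shows "douglas_rachford A B c = c"
  using assms
  by (simp add: douglas_rachford_def reflection_def nearest_point_proj_in scaleR_2)

text \<open>A fixed point satisfies \<open>x = reflection B (reflection A x)\<close>; unfolding the
  reflections identifies the projection of \<open>x\<close> onto \<open>A\<close> with a projection
  onto \<open>B\<close>.\<close>

lemma douglas_rachford_fixed_pointD:
  fixes A B :: "'a::{real_inner,banach} set"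
  assumes "closed B" "convex B" "B \<noteq> {}" and fix_x: "douglas_rachford A B x = x"
  shows "nearest_point_proj A x \<in> B"
proof -
  have "2 *\<^sub>R x = x + reflection B (reflection A x)"
    by (subst (1) fix_x[symmetric]) (simp add: douglas_rachford_def)
  then have "x = reflection B (reflection A x)"
    by (simp add: scaleR_2)
  also have "\<dots> = 2 *\<^sub>R nearest_point_proj B (reflection A x) - (2 *\<^sub>R nearest_point_proj A x - x)"
    by (simp only: reflection_def)
  finally have "2 *\<^sub>R nearest_point_proj B (reflection A x) = 2 *\<^sub>R nearest_point_proj A x"
    by (simp add: algebra_simps)
  then have "nearest_point_proj A x = nearest_point_proj B (reflection A x)"
    by simp
  then show ?thesis
    using nearest_point_proj(1)[OF assms(1-3)] by simp
qed

lemma cyclic_projections_eq: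
  fixes C :: "nat \<Rightarrow> 'a::{real_inner,banach} set"
  assumes C: "\<And>i. i \<in> {1..N + 1} \<Longrightarrow> closed (C i) \<and> convex (C i) \<and> C i \<noteq> {}"
    and cyc: "C (N + 1) = C 1"
    and next_in: "\<And>i. i \<in> {1..N} \<Longrightarrow> nearest_point_proj (C i) x \<in> C (i + 1)"
    and "i \<in> {1..N + 1}"
  shows "nearest_point_proj (C i) x = nearest_point_proj (C 1) x"
proof -
  define d where "d j = dist x (nearest_point_proj (C j) x)" for j
  have step: "d (Suc j) \<le> d j" if "j \<in> {1..N}" for j
    unfolding d_def using that C next_in[OF that] by (intro nearest_point_proj(2)) auto
  have anti: "d k \<le> d j" if "j \<le> k" "1 \<le> j" "k \<le> N + 1" for j k
    using that
  proof (induction k rule: dec_induct)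
    case (step k)
    then show ?case
      using \<open>\<And>j. j \<in> {1..N} \<Longrightarrow> d (Suc j) \<le> d j\<close>[of k] by force
  qed simp
  \<comment> \<open>Each \<open>d j\<close> lies between \<open>d (N + 1)\<close> and
    \<open>d 1\<close>, which agree because the cycle closes.\<close>
  have d_eq: "d j = d 1" if "j \<in> {1..N + 1}" for j
    using anti[of 1 j] anti[of j "N + 1"] that cyc by (auto simp: d_def)
  \<comment> \<open>The projection onto \<open>C j\<close> is a point of \<open>C (Suc j)\<close> at
    the minimal distance \<open>d (Suc j)\<close>, so it is the nearest point there too.\<close>
  have eq_next: "nearest_point_proj (C (Suc j)) x = nearest_point_proj (C j) x" if "j \<in> {1..N}" for j
    using that C next_in[OF that] d_eq[of j] d_eq[of "Suc j"]
    by (intro nearest_point_proj_unique) (auto simp: d_def)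
  have "1 \<le> i" "i \<le> N + 1"
    using assms by auto
  then show ?thesis
  proof (induction i rule: dec_induct)
    case (step j)
    then show ?case
      using eq_next[of j] by simp
  qed simp
qed

section \<open>Convergence of the averaged iteration\<close>

theorem theorem3p3:
  fixes C :: "nat \<Rightarrow> 'a::{real_inner,banach} set"
    and N :: nat
    and x :: "nat \<Rightarrow> 'a"
  assumes "N \<ge> 1"
    and "\<And>i. i \<in> {1..N} \<Longrightarrow> closed (C i)"
    and "\<And>i. i \<in> {1..N} \<Longrightarrow> convex (C i)"
    and "(\<Inter>i\<in>{1..N}. C i) \<noteq> {}"
    and "C (N + 1) = C 1"
    and "\<And>n. x (Suc n) = (1 / real N) *\<^sub>R (\<Sum>i = 1..N. douglas_rachford (C i) (C (i + 1)) (x n))"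
  shows "\<exists>l. weakly_converges x l
    \<and> (\<forall>i\<in>{1..N}. \<forall>j\<in>{1..N}. nearest_point_proj (C i) l = nearest_point_proj (C j) l)
    \<and> (\<forall>j\<in>{1..N}. nearest_point_proj (C j) l \<in> (\<Inter>i\<in>{1..N}. C i))"
proof -
  obtain c where c: "\<And>i. i \<in> {1..N} \<Longrightarrow> c \<in> C i"
    using assms(4) by blast
  have C: "closed (C i) \<and> convex (C i) \<and> c \<in> C i" if "i \<in> {1..N + 1}" for i
    using that assms(1,2,3,5) c by (cases "i = N + 1") auto
  define T where "T i = douglas_rachford (C i) (C (i + 1))" for i
  define U where "U = (\<lambda>z. (1 / real (card {1..N})) *\<^sub>R (\<Sum>i\<in>{1..N}. T i z))"
  have T: "firmly_nonexpansive (T i)" "T i c = c" if "i \<in> {1..N}" for i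
    unfolding T_def using C[of i] C[of "i + 1"] that
    by (auto intro!: firmly_nonexpansive_douglas_rachford douglas_rachford_common_point)
  have U: "firmly_nonexpansive U"
    unfolding U_def using T by (intro firmly_nonexpansive_mean)
  have "U c = c"
    using T(2) \<open>N \<ge> 1\<close> by (simp add: U_def sum_constant_scaleR)
  have x: "x (Suc n) = U (x n)" for n
    using assms(6) by (simp add: U_def T_def)
  obtain l where l: "U l = l" "weakly_converges x l"
    using weakly_converges_nonexpansive_orbit[of U c x] firmly_nonexpansive_norm_le[OF U]
      firmly_nonexpansive_asymptotically_regular[OF U] \<open>U c = c\<close> x by metis
  have "T i l = l" if "i \<in> {1..N}" for i
    using fixed_point_mean_firmly_nonexpansive[of "{1..N}" i T c l] that T l(1) by (simp add: U_def)
  then have next_in: "nearest_point_proj (C i) l \<in> C (i + 1)" if "i \<in> {1..N}" for i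
    using that C[of "i + 1"] by (intro douglas_rachford_fixed_pointD) (auto simp: T_def)
  have eq: "nearest_point_proj (C i) l = nearest_point_proj (C 1) l" if "i \<in> {1..N}" for i
    using that C by (intro cyclic_projections_eq[of N C] assms(5) next_in) auto
  \<comment> \<open>The projections onto \<open>C i\<close> and \<open>C j\<close> are the same
    point, and the former lies in \<open>C i\<close>.\<close>
  have "nearest_point_proj (C j) l \<in> C i" if "i \<in> {1..N}" "j \<in> {1..N}" for i j
    using nearest_point_proj(1)[of "C i" l] C[of i] eq[OF that(1)] eq[OF that(2)] that by auto
  moreover have "\<forall>i\<in>{1..N}. \<forall>j\<in>{1..N}. nearest_point_proj (C i) l = nearest_point_proj (C j) l"
    using eq by metis
  ultimately show ?thesis
    using l(2) by blast
qed

end
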